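(* For every derivation in the sequent system $\mathsf{GS1p}+\mathsf{Cut}$ with premises $\Sigma_1,\dots,\Sigma_h$ ($h\ge 0$) and conclusion $\Sigma$, there exists a derivation in the system $\mathsf{SKSg}\setminus\{c{\uparrow},w{\uparrow}\}$ of the calculus of structures with premise $(\underline{\Sigma_1}_{S},\dots,\underline{\Sigma_h}_{S})$ and conclusion $\underline{\Sigma}_{S}$, with the same number of cuts (the number of instances of $i{\uparrow}$ equals the number of instances of $\mathsf{Cut}$ in the given derivation). For $h=0$ the empty conjunction is read as the unit $\mathsf t$.
   Context: Structures: generated by $S ::= \mathsf f \mid \mathsf t \mid a \mid [S,\dots,S] \mid (S,\dots,S) \mid \bar S$ (non-empty lists), where $a$ ranges over atoms, $\mathsf f,\mathsf t$ are the units false and true, $[\cdot]$ is disjunction, $(\cdot)$ is conjunction, $\bar S$ is negation; the negation of an atom is again an atom. A context $S\{\ \}$ is a structure with one occurrence of a hole, not in the scope of a negation; $S\{R\}$ is the result of filling it with $R$; $S[R,T]$ abbreviates $S\{[R,T]\}$ and $S(R,T)$ abbreviates $S\{(R,T)\}$. Equivalent structures are not distinguished; equivalence is the smallest equivalence relation induced by: $[\vec R,[\vec T],\vec U]=[\vec R,\vec T,\vec U]$ and $(\vec R,(\vec T),\vec U)=(\vec R,\vec T,\vec U)$ (with $\vec R,\vec T,\vec U$ finite sequences, $\vec T$ non-empty); $[R,T]=[T,R]$, $(R,T)=(T,R)$; $(\mathsf f,\mathsf f)=\mathsf f$, $[\mathsf f,R]=R$, $[\mathsf t,\mathsf t]=\mathsf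 t$, $(\mathsf t,R)=R$; $\bar{\mathsf f}=\mathsf t$, $\bar{\mathsf t}=\mathsf f$, $\overline{[R,T]}=(\bar R,\bar T)$, $\overline{(R,T)}=[\bar R,\bar T]$, $\bar{\bar R}=R$; and closure: if $R=T$ then $S\{R\}=S\{T\}$ and $\bar R=\bar T$. A derivation in a system (set of inference rules) is a finite sequence of rule instances, read top-down, the conclusion of each being the premise of the next; it may consist of a single structure. Its premise is the topmost structure, its conclusion the bottommost. System $\mathsf{SKSg}$ has the rules (written $\frac{\text{premise}}{\text{conclusion}}$, for arbitrary structures $R,T,U$ and contexts $S\{\ \}$): $i{\downarrow}:\frac{S\{\mathsf t\}}{S[R,\bar R]}$, $i{\uparrow}$ (cut)$:\frac{S(R,\bar R)}{S\{\mathsf f\}}$, $s:\frac{S([R,U],T)}{S[(R,T),U]}$, $w{\downarrow}:\frac{S\{\mathsf f\}}{S\{R\}}$, $w{\uparrow}:\frac{S\{R\}}{S\{\mathsf t\}}$, $c{\downarrow}:\frac{S[R,R]}{S\{R\}}$, $c{\uparrow}:\frac{S\{R\}}{S(R,R)}$. Sequent system: formulae $A,B$ are built from atoms (closed under negation) and constants $\top,\bot$ with $\wedge,\vee$; negation occurs only on atoms and $\bar A$ denotes the De Morgan dual of $A$. Sequents are finite multisets of formulae; $\Phi,\Psi$ denote multisets and comma is multiset union. $\mathsf{GS1p}$ has the rules: axiom $\top$: infer $\vdash\top$; $\mathsf{Ax}$: infer $\vdash A,\bar A$; $\mathsf R\wedge$: from $\vdash\Phi,A$ and $\vdash\Psi,B$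 infer $\vdash\Phi,\Psi,A\wedge B$; $\mathsf R\vee$: from $\vdash\Phi,A,B$ infer $\vdash\Phi,A\vee B$; $\mathsf{RC}$: from $\vdash\Phi,A,A$ infer $\vdash\Phi,A$; $\mathsf{RW}$: from $\vdash\Phi$ infer $\vdash\Phi,A$. $\mathsf{GS1p}+\mathsf{Cut}$ adds $\mathsf{Cut}$: from $\vdash\Phi,A$ and $\vdash\Psi,\bar A$ infer $\vdash\Phi,\Psi$. Derivations are trees built by these rules; the premises $\Sigma_1,\dots,\Sigma_h$ are the open leaves (leaves not closed by an axiom). Translation $\underline{\ \cdot\ }_S$: $\underline a_S=a$, $\underline\top_S=\mathsf t$, $\underline\bot_S=\mathsf f$, $\underline{A\vee B}_S=[\underline A_S,\underline B_S]$, $\underline{A\wedge B}_S=(\underline A_S,\underline B_S)$, $\underline{\emptyset}_S=\mathsf f$, and $\underline{A_1,\dots,A_h}_S=[\underline{A_1}_S,\dots,\underline{A_h}_S]$ for $h>0$. *)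

theory Defs
  imports Main "HOL-Library.Multiset"
begin

section \<open>Atoms\<close>

text \<open>Fixed points of negation are not excluded; nothing below depends on their absence.\<close>

class atom =
  fixes neg_atom :: "'a \<Rightarrow> 'a"
  assumes neg_atom_neg_atom [simp]: "neg_atom (neg_atom a) = a"


section \<open>The calculus of structures\<close>

text \<open>The arguments of \<open>Dis\<close> and \<open>Con\<close> are non-empty lists, given as head and tail.\<close>

datatype 'a struct =
    FF
  | TT
  | At 'a
  | Dis "'a struct" "'a struct list"
  | Con "'a struct" "'a struct list"
  | Neg "'a struct"

text \<open>\<open>dis Rs\<close> and \<open>con Rs\<close> are \<open>[Rs]\<close> and \<open>(Rs)\<close>; they are meaningful for \<open>Rs \<noteq> []\<close> only
  and are never applied to the empty list below.\<close>

definition dis :: "'a struct list \<Rightarrow> 'a struct" where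
  "dis Rs = Dis (hd Rs) (tl Rs)"

definition con :: "'a struct list \<Rightarrow> 'a struct" where
  "con Rs = Con (hd Rs) (tl Rs)"

datatype 'a ctx =
    Hole
  | DisC "'a struct list" "'a ctx" "'a struct list"
  | ConC "'a struct list" "'a ctx" "'a struct list"

primrec fill :: "'a ctx \<Rightarrow> 'a struct \<Rightarrow> 'a struct" where
  "fill Hole X = X"
| "fill (DisC Rs S Us) X = dis (Rs @ [fill S X] @ Us)"
| "fill (ConC Rs S Us) X = con (Rs @ [fill S X] @ Us)"

text \<open>Rule \<open>eq_neg_at\<close> expresses that the negation of an atom is again an atom.\<close>

inductive struct_eq :: "'a::atom struct \<Rightarrow> 'a struct \<Rightarrow> bool" (infix "\<approx>" 50) where
  eq_refl: "R \<approx> R"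
| eq_sym: "R \<approx> T \<Longrightarrow> T \<approx> R"
| eq_trans: "R \<approx> T \<Longrightarrow> T \<approx> U \<Longrightarrow> R \<approx> U"
| eq_dis_assoc: "Ts \<noteq> [] \<Longrightarrow> dis (Rs @ [dis Ts] @ Us) \<approx> dis (Rs @ Ts @ Us)"
| eq_con_assoc: "Ts \<noteq> [] \<Longrightarrow> con (Rs @ [con Ts] @ Us) \<approx> con (Rs @ Ts @ Us)"
| eq_dis_comm: "dis [R, T] \<approx> dis [T, R]"
| eq_con_comm: "con [R, T] \<approx> con [T, R]"
| eq_con_FF: "con [FF, FF] \<approx> FF"
| eq_dis_FF: "dis [FF, R] \<approx> R"
| eq_dis_TT: "dis [TT, TT] \<approx> TT"
| eq_con_TT: "con [TT, R] \<approx> R"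
| eq_neg_FF: "Neg FF \<approx> TT"
| eq_neg_TT: "Neg TT \<approx> FF"
| eq_neg_dis: "Neg (dis [R, T]) \<approx> con [Neg R, Neg T]"
| eq_neg_con: "Neg (con [R, T]) \<approx> dis [Neg R, Neg T]"
| eq_neg_neg: "Neg (Neg R) \<approx> R"
| eq_neg_at: "Neg (At a) \<approx> At (neg_atom a)"
| eq_ctx: "R \<approx> T \<Longrightarrow> fill S R \<approx> fill S T"
| eq_neg: "R \<approx> T \<Longrightarrow> Neg R \<approx> Neg T"

datatype sks_rule = I_down | I_up | Switch | W_down | W_up | C_down | C_up

inductive sks_inst :: "sks_rule \<Rightarrow> 'a struct \<Rightarrow> 'a struct \<Rightarrow> bool" where
  "sks_inst I_down (fill S TT) (fill S (dis [R, Neg R]))"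
| "sks_inst I_up (fill S (con [R, Neg R])) (fill S FF)"
| "sks_inst Switch (fill S (con [dis [R, U], T])) (fill S (dis [con [R, T], U]))"
| "sks_inst W_down (fill S FF) (fill S R)"
| "sks_inst W_up (fill S R) (fill S TT)"
| "sks_inst C_down (fill S (dis [R, R])) (fill S R)"
| "sks_inst C_up (fill S R) (fill S (con [R, R]))"

definition SKSg :: "sks_rule set" where
  "SKSg = {I_down, I_up, Switch, W_down, W_up, C_down, C_up}"

text \<open>A derivation consists of its premise and a list of steps, each recording a rule name and
  the structure obtained. Equivalent structures are not distinguished: a step is an instance
  of its rule up to \<open>\<approx>\<close> on both sides.\<close>

datatype 'a sks_deriv = Deriv (sks_premise: "'a struct") (sks_steps: "(sks_rule \<times> 'a struct) list")

fun steps_ok :: "sks_rule set \<Rightarrow> 'a::atom struct \<Rightarrow> (sks_rule \<times> 'a struct) list \<Rightarrow> bool" where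
  "steps_ok \<S> P [] \<longleftrightarrow> True"
| "steps_ok \<S> P ((r, Q) # steps) \<longleftrightarrow>
     r \<in> \<S> \<and> (\<exists>P' Q'. P \<approx> P' \<and> sks_inst r P' Q' \<and> Q' \<approx> Q) \<and> steps_ok \<S> Q steps"

definition sks_derivation :: "sks_rule set \<Rightarrow> 'a::atom sks_deriv \<Rightarrow> bool" where
  "sks_derivation \<S> \<Delta> \<longleftrightarrow> steps_ok \<S> (sks_premise \<Delta>) (sks_steps \<Delta>)"

definition sks_conclusion :: "'a sks_deriv \<Rightarrow> 'a struct" where
  "sks_conclusion \<Delta> = last (sks_premise \<Delta> # map snd (sks_steps \<Delta>))"

definition sks_cuts :: "'a sks_deriv \<Rightarrow> nat" where
  "sks_cuts \<Delta> = count_list (map fst (sks_steps \<Delta>)) I_up"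


section \<open>The sequent system\<close>

datatype 'a form =
    Lit 'a
  | Top
  | Bot
  | And "'a form" "'a form"
  | Or "'a form" "'a form"

primrec dual :: "'a::atom form \<Rightarrow> 'a form" where
  "dual (Lit a) = Lit (neg_atom a)"
| "dual Top = Bot"
| "dual Bot = Top"
| "dual (And A B) = Or (dual A) (dual B)"
| "dual (Or A B) = And (dual A) (dual B)"

type_synonym 'a sequent = "'a form multiset"

datatype gs_rule = AxTop | Ax | RAnd | ROr | RC | RW | Cut

inductive gs_inst :: "gs_rule \<Rightarrow> 'a::atom sequent list \<Rightarrow> 'a sequent \<Rightarrow> bool" where
  "gs_inst AxTop [] {#Top#}"
| "gs_inst Ax [] {#A, dual A#}"
| "gs_inst RAnd [\<Phi> + {#A#}, \<Psi> + {#B#}] (\<Phi> + \<Psi> + {#And A B#})"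
| "gs_inst ROr [\<Phi> + {#A, B#}] (\<Phi> + {#Or A B#})"
| "gs_inst RC [\<Phi> + {#A, A#}] (\<Phi> + {#A#})"
| "gs_inst RW [\<Phi>] (\<Phi> + {#A#})"
| "gs_inst Cut [\<Phi> + {#A#}, \<Psi> + {#dual A#}] (\<Phi> + \<Psi>)"

text \<open>\<open>Open \<Sigma>\<close> is an open leaf, i.e. a premise of the derivation; applications of
  the axioms are \<open>Infer\<close> nodes without subtrees.\<close>

datatype 'a gs_deriv =
    Open "'a sequent"
  | Infer gs_rule "'a sequent" "'a gs_deriv list"

primrec gs_conclusion :: "'a gs_deriv \<Rightarrow> 'a sequent" where
  "gs_conclusion (Open \<Sigma>) = \<Sigma>"
| "gs_conclusion (Infer r \<Sigma> Ds) = \<Sigma>"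

primrec gs_premises :: "'a gs_deriv \<Rightarrow> 'a sequent list" where
  "gs_premises (Open \<Sigma>) = [\<Sigma>]"
| "gs_premises (Infer r \<Sigma> Ds) = concat (map gs_premises Ds)"

primrec gs_cuts :: "'a gs_deriv \<Rightarrow> nat" where
  "gs_cuts (Open \<Sigma>) = 0"
| "gs_cuts (Infer r \<Sigma> Ds) = (if r = Cut then 1 else 0) + sum_list (map gs_cuts Ds)"

definition GS1p :: "gs_rule set" where
  "GS1p = {AxTop, Ax, RAnd, ROr, RC, RW}"

primrec gs_derivation :: "gs_rule set \<Rightarrow> 'a::atom gs_deriv \<Rightarrow> bool" where
  "gs_derivation \<S> (Open \<Sigma>) \<longleftrightarrow> True"
| "gs_derivation \<S> (Infer r \<Sigma> Ds) \<longleftrightarrow>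
     r \<in> \<S> \<and> gs_inst r (map gs_conclusion Ds) \<Sigma> \<and> list_all (gs_derivation \<S>) Ds"


section \<open>Translation\<close>

primrec form_struct :: "'a form \<Rightarrow> 'a struct" where
  "form_struct (Lit a) = At a"
| "form_struct Top = TT"
| "form_struct Bot = FF"
| "form_struct (Or A B) = dis [form_struct A, form_struct B]"
| "form_struct (And A B) = con [form_struct A, form_struct B]"

text \<open>A sequent is a multiset, so its translation depends on an enumeration of its elements;
  different enumerations give equivalent structures (\<open>sequent_struct_mset\<close> below).\<close>

definition forms_struct :: "'a form list \<Rightarrow> 'a struct" where
  "forms_struct As = (if As = [] then FF else dis (map form_struct As))"

definition sequent_struct :: "'a sequent \<Rightarrow> 'a struct" where
  "sequent_struct \<Sigma> = forms_struct (SOME As. mset As = \<Sigma>)"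

definition premises_struct :: "'a sequent list \<Rightarrow> 'a struct" where
  "premises_struct \<Sigma>s = (if \<Sigma>s = [] then TT else con (map sequent_struct \<Sigma>s))"

lemma dis_swap: "dis (Rs @ [A, B] @ Us) \<approx> dis (Rs @ [B, A] @ Us)"
proof -
  have "dis (Rs @ [dis [A, B]] @ Us) \<approx> dis (Rs @ [dis [B, A]] @ Us)"
    using eq_ctx[OF eq_dis_comm[of A B], of "DisC Rs Hole Us"] by simp
  moreover have "dis (Rs @ [dis [A, B]] @ Us) \<approx> dis (Rs @ [A, B] @ Us)"
    and "dis (Rs @ [dis [B, A]] @ Us) \<approx> dis (Rs @ [B, A] @ Us)"
    by (rule eq_dis_assoc, simp)+
  ultimately show ?thesis by (blast intro: eq_sym eq_trans)
qed

lemma dis_move: "dis (Rs @ Ts @ A # Us) \<approx> dis (Rs @ A # Ts @ Us)"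
proof (induction Ts arbitrary: Us rule: rev_induct)
  case Nil
  show ?case by (simp add: eq_refl)
next
  case (snoc B Ts)
  from dis_swap[of "Rs @ Ts" B A Us] snoc.IH[of "B # Us"] show ?case
    by (auto intro: eq_trans)
qed

lemma dis_mset: "mset Ts = mset Ts' \<Longrightarrow> dis (Rs @ Ts) \<approx> dis (Rs @ Ts')"
proof (induction Ts arbitrary: Rs Ts')
  case Nil
  then show ?case by (simp add: eq_refl)
next
  case (Cons A Ts)
  from Cons.prems have "A \<in> set Ts'" by (metis list.set_intros(1) mset_eq_setD)
  then obtain Us Vs where Ts': "Ts' = Us @ A # Vs" by (meson split_list)
  with Cons.prems have "mset Ts = mset (Us @ Vs)" by simp
  from Cons.IH[OF this, of "Rs @ [A]"] have "dis (Rs @ A # Ts) \<approx> dis (Rs @ A # Us @ Vs)"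
    by simp
  with dis_move[of Rs Us A Vs] show ?case unfolding Ts' by (blast intro: eq_sym eq_trans)
qed

lemma sequent_struct_mset: "sequent_struct (mset As) \<approx> forms_struct As"
proof -
  let ?Bs = "SOME Bs. mset Bs = mset As"
  have eq: "mset ?Bs = mset As" by (rule someI[of _ As]) simp
  then have "?Bs = [] \<longleftrightarrow> As = []" by (metis mset_zero_iff)
  moreover have "mset (map form_struct ?Bs) = mset (map form_struct As)"
    using eq by simp
  then have "dis (map form_struct ?Bs) \<approx> dis (map form_struct As)"
    using dis_mset[where Rs = "[]"] by (metis append_Nil)
  ultimately show ?thesis
    by (auto simp: sequent_struct_def forms_struct_def eq_refl)
qed

end

theory Submission
  imports Defs
begin

text \<open>A rule of the sequent system with premises \<open>\<Sigma>\<^sub>1, \<dots>, \<Sigma>\<^sub>k\<close> becomes a derivation from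
  the conjunction of their translations: the branching rules use two switches to bring the
  principal formulae together, and \<open>Cut\<close> then closes with a single \<open>i\<up>\<close>. Derivations of the
  premises are composed one after the other inside contexts, so a tree is linearised without
  duplicating any part of it, and the number of cuts is preserved.\<close>

section \<open>Equivalence of structures\<close>

declare eq_trans [trans]

lemma dis_cong:
  assumes "A \<approx> A'" and "B \<approx> B'"
  shows "dis [A, B] \<approx> dis [A', B']"
proof -
  have "dis [A, B] \<approx> dis [A', B]"
    using eq_ctx[OF assms(1), of "DisC [] Hole [B]"] by simp
  also have "dis [A', B] \<approx> dis [A', B']"
    using eq_ctx[OF assms(2), of "DisC [A'] Hole []"] by simp
  finally show ?thesis .
qed

text \<open>No clause of \<open>\<approx>\<close> removes a singleton bracket directly. Adding the
  unit \<open>FF\<close> puts \<open>dis [A]\<close> inside a larger disjunction, where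
  associativity flattens it, and the unit is then dropped.\<close>

lemma dis_singleton: "dis [A] \<approx> A"
proof -
  have "dis [A] \<approx> dis [FF, dis [A]]"
    by (rule eq_sym, rule eq_dis_FF)
  also have "\<dots> \<approx> dis [FF, A]"
    using eq_dis_assoc[of "[A]" "[FF]" "[]"] by simp
  also have "\<dots> \<approx> A"
    by (rule eq_dis_FF)
  finally show ?thesis .
qed

lemma dis_FF_right: "dis [A, FF] \<approx> A"
  by (blast intro: eq_trans eq_dis_comm eq_dis_FF)

lemma dis_append:
  assumes "As \<noteq> []" and "Bs \<noteq> []"
  shows "dis (As @ Bs) \<approx> dis [dis As, dis Bs]"
proof -
  have "dis [dis As, dis Bs] \<approx> dis (As @ [dis Bs])"
    using eq_dis_assoc[OF assms(1), of "[]" "[dis Bs]"] by simp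
  also have "\<dots> \<approx> dis (As @ Bs)"
    using eq_dis_assoc[OF assms(2), of As "[]"] by simp
  finally show ?thesis by (rule eq_sym)
qed

lemma con_cong:
  assumes "A \<approx> A'" and "B \<approx> B'"
  shows "con [A, B] \<approx> con [A', B']"
proof -
  have "con [A, B] \<approx> con [A', B]"
    using eq_ctx[OF assms(1), of "ConC [] Hole [B]"] by simp
  also have "con [A', B] \<approx> con [A', B']"
    using eq_ctx[OF assms(2), of "ConC [A'] Hole []"] by simp
  finally show ?thesis .
qed

lemma con_singleton: "con [A] \<approx> A"
proof -
  have "con [A] \<approx> con [TT, con [A]]"
    by (rule eq_sym, rule eq_con_TT)
  also have "\<dots> \<approx> con [TT, A]"
    using eq_con_assoc[of "[A]" "[TT]" "[]"] by simp
  also have "\<dots> \<approx> A"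
    by (rule eq_con_TT)
  finally show ?thesis .
qed

lemma con_TT_right: "con [A, TT] \<approx> A"
  by (blast intro: eq_trans eq_con_comm eq_con_TT)

lemma con_append:
  assumes "As \<noteq> []" and "Bs \<noteq> []"
  shows "con (As @ Bs) \<approx> con [con As, con Bs]"
proof -
  have "con [con As, con Bs] \<approx> con (As @ [con Bs])"
    using eq_con_assoc[OF assms(1), of "[]" "[con Bs]"] by simp
  also have "\<dots> \<approx> con (As @ Bs)"
    using eq_con_assoc[OF assms(2), of As "[]"] by simp
  finally show ?thesis by (rule eq_sym)
qed

section \<open>Translation of duals, sequents and premise lists up to equivalence\<close>

text \<open>Connects the two notions of negation: \<open>Neg\<close> is a constructor governed by
  equations, whereas \<open>dual\<close> is computed on formulae. This lets \<open>Ax\<close> and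
  \<open>Cut\<close> be matched with \<open>I_down\<close> and \<open>I_up\<close>.\<close>

lemma Neg_form_struct: "Neg (form_struct A) \<approx> form_struct (dual A)"
proof (induction A)
  case (And A B)
  then show ?case by (auto intro: eq_trans[OF eq_neg_con] dis_cong)
next
  case (Or A B)
  then show ?case by (auto intro: eq_trans[OF eq_neg_dis] con_cong)
qed (auto intro: eq_neg_at eq_neg_TT eq_neg_FF)

lemma forms_struct_append: "forms_struct (As @ Bs) \<approx> dis [forms_struct As, forms_struct Bs]"
  using dis_append[of "map form_struct As" "map form_struct Bs"]
  by (auto simp: forms_struct_def intro: eq_sym eq_dis_FF dis_FF_right)

text \<open>Concatenating enumerations of \<open>\<Phi>\<close> and \<open>\<Psi>\<close> gives one
  of the union, and up to \<open>\<approx>\<close> any enumeration may replace the chosen one. Empty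
  multisets are covered because \<open>FF\<close> is the unit of disjunction.\<close>

lemma sequent_struct_union:
  "sequent_struct (\<Phi> + \<Psi>) \<approx> dis [sequent_struct \<Phi>, sequent_struct \<Psi>]"
proof -
  obtain As Bs where [simp]: "\<Phi> = mset As" "\<Psi> = mset Bs"
    by (metis ex_mset)
  have "sequent_struct (\<Phi> + \<Psi>) \<approx> forms_struct (As @ Bs)"
    using sequent_struct_mset[of "As @ Bs"] by simp
  also note forms_struct_append
  also have "dis [forms_struct As, forms_struct Bs] \<approx> dis [sequent_struct \<Phi>, sequent_struct \<Psi>]"
    by (auto intro: dis_cong eq_sym sequent_struct_mset)
  finally show ?thesis .
qed

lemma sequent_struct_single: "sequent_struct {#A#} \<approx> form_struct A"
proof -
  have "sequent_struct {#A#} \<approx> dis [form_struct A]"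
    using sequent_struct_mset[of "[A]"] by (simp add: forms_struct_def)
  also note dis_singleton
  finally show ?thesis .
qed

lemma sequent_struct_add:
  "sequent_struct (\<Phi> + {#A#}) \<approx> dis [sequent_struct \<Phi>, form_struct A]"
  by (rule eq_trans[OF sequent_struct_union dis_cong[OF eq_refl sequent_struct_single]])

lemma sequent_struct_add_swap:
  "sequent_struct (\<Phi> + {#A#}) \<approx> dis [form_struct A, sequent_struct \<Phi>]"
  by (rule eq_trans[OF sequent_struct_add eq_dis_comm])

lemma sequent_struct_pair: "sequent_struct {#A, B#} \<approx> dis [form_struct A, form_struct B]"
  using sequent_struct_mset[of "[A, B]"] by (simp add: forms_struct_def)

lemma sequent_struct_add_pair:
  "sequent_struct (\<Phi> + {#A, B#}) \<approx> dis [sequent_struct \<Phi>, dis [form_struct A, form_struct B]]"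
  by (rule eq_trans[OF sequent_struct_union dis_cong[OF eq_refl sequent_struct_pair]])

lemma premises_struct_single: "premises_struct [\<Sigma>] \<approx> sequent_struct \<Sigma>"
  by (simp add: premises_struct_def con_singleton)

text \<open>Reading the empty conjunction as \<open>TT\<close>, the unit of conjunction, makes this
  hold for empty lists too.\<close>

lemma premises_struct_append:
  "premises_struct (\<Sigma>s @ \<Sigma>s') \<approx> con [premises_struct \<Sigma>s, premises_struct \<Sigma>s']"
  using con_append[of "map sequent_struct \<Sigma>s" "map sequent_struct \<Sigma>s'"]
  by (auto simp: premises_struct_def intro: eq_sym eq_con_TT con_TT_right)

lemma premises_struct_Cons:
  "premises_struct (\<Sigma> # \<Sigma>s) \<approx> con [sequent_struct \<Sigma>, premises_struct \<Sigma>s]"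
  using eq_trans[OF premises_struct_append[of "[\<Sigma>]" \<Sigma>s] con_cong[OF premises_struct_single eq_refl]]
  by simp

lemma premises_struct_pair:
  "premises_struct [\<Sigma>, \<Sigma>'] \<approx> con [sequent_struct \<Sigma>, sequent_struct \<Sigma>']"
  by (rule eq_trans[OF premises_struct_Cons con_cong[OF eq_refl premises_struct_single]])


section \<open>Derivability with a given number of cuts\<close>

text \<open>The conclusion is taken only up to \<open>\<approx>\<close>, so that an equivalence
  counts as a derivation without steps and without cuts.\<close>

definition derives :: "sks_rule set \<Rightarrow> nat \<Rightarrow> 'a::atom struct \<Rightarrow> 'a struct \<Rightarrow> bool" where
  "derives \<S> n P Q \<longleftrightarrow> (\<exists>\<Delta>. sks_derivation \<S> \<Delta> \<and> sks_premise \<Delta> = P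
     \<and> sks_conclusion \<Delta> \<approx> Q \<and> sks_cuts \<Delta> = n)"

lemma derives_steps:
  "derives \<S> n P Q \<longleftrightarrow> (\<exists>steps. steps_ok \<S> P steps \<and> last (P # map snd steps) \<approx> Q
     \<and> count_list (map fst steps) I_up = n)"
  unfolding derives_def sks_derivation_def sks_conclusion_def sks_cuts_def
  by (metis sks_deriv.sel sks_deriv.exhaust)

lemma derives_eq: "P \<approx> Q \<Longrightarrow> derives \<S> 0 P Q"
  unfolding derives_steps by (intro exI[of _ "[]"]) simp

lemma derives_rule:
  assumes "r \<in> \<S>" and "sks_inst r P Q"
  shows "derives \<S> (if r = I_up then 1 else 0) P Q"
  unfolding derives_steps
  using assms by (intro exI[of _ "[(r, Q)]"]) (auto intro: eq_refl)

section \<open>Composition of derivations\<close>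

lemma steps_ok_append:
  "steps_ok \<S> P (xs @ ys) \<longleftrightarrow> steps_ok \<S> P xs \<and> steps_ok \<S> (last (P # map snd xs)) ys"
  by (induction \<S> P xs rule: steps_ok.induct) auto

text \<open>The first step absorbs the equivalence, since rule instances are taken up to
  \<open>\<approx>\<close>. This permits gluing where the structures at the joint are merely
  equivalent.\<close>

lemma steps_ok_eq: "steps_ok \<S> P steps \<Longrightarrow> P' \<approx> P \<Longrightarrow> steps_ok \<S> P' steps"
  by (cases steps) (auto, blast intro: eq_trans)

lemma derives_trans [trans]:
  assumes "derives \<S> m P Q" and "derives \<S> n Q R"
  shows "derives \<S> (m + n) P R"
proof -
  obtain xs where xs: "steps_ok \<S> P xs" "last (P # map snd xs) \<approx> Q"
    "count_list (map fst xs) I_up = m"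
    using assms(1) unfolding derives_steps by blast
  obtain ys where ys: "steps_ok \<S> Q ys" "last (Q # map snd ys) \<approx> R"
    "count_list (map fst ys) I_up = n"
    using assms(2) unfolding derives_steps by blast
  have "steps_ok \<S> P (xs @ ys)"
    using xs ys steps_ok_eq by (auto simp: steps_ok_append)
  \<comment> \<open>If \<open>ys\<close> is empty, the last structure comes from \<open>xs\<close>
    and reaches \<open>R\<close> through \<open>Q\<close>; otherwise it is that of
    \<open>ys\<close>.\<close>
  moreover have "last (P # map snd (xs @ ys)) \<approx> R"
    using xs(2) ys(2) by (cases "ys = []") (auto intro: eq_trans split: if_splits)
  moreover have "count_list (map fst (xs @ ys)) I_up = m + n"
    using xs(3) ys(3) by simp
  ultimately show ?thesis unfolding derives_steps by blast
qed

lemma derives_eq_trans [trans]: "P \<approx> Q \<Longrightarrow> derives \<S> n Q R \<Longrightarrow> derives \<S> n P R"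
  using derives_trans[OF derives_eq] by fastforce

lemma derives_trans_eq [trans]: "derives \<S> n P Q \<Longrightarrow> Q \<approx> R \<Longrightarrow> derives \<S> n P R"
  using derives_trans[OF _ derives_eq] by fastforce

section \<open>Derivations inside contexts\<close>

primrec ctx_comp :: "'a ctx \<Rightarrow> 'a ctx \<Rightarrow> 'a ctx" where
  "ctx_comp Hole S' = S'"
| "ctx_comp (DisC Rs S Us) S' = DisC Rs (ctx_comp S S') Us"
| "ctx_comp (ConC Rs S Us) S' = ConC Rs (ctx_comp S S') Us"

lemma fill_ctx_comp: "fill (ctx_comp S S') X = fill S (fill S' X)"
  by (induction S) auto

text \<open>An instance in a context \<open>S'\<close>, placed inside \<open>S\<close>, is an
  instance of the same rule in the composed context \<open>ctx_comp S S'\<close>.\<close>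

lemma sks_inst_fill: "sks_inst r P Q \<Longrightarrow> sks_inst r (fill S P) (fill S Q)"
  by (induction rule: sks_inst.induct) (auto simp flip: fill_ctx_comp intro: sks_inst.intros)

lemma steps_ok_fill:
  "steps_ok \<S> P steps \<Longrightarrow> steps_ok \<S> (fill S P) (map (map_prod id (fill S)) steps)"
  by (induction \<S> P steps rule: steps_ok.induct) (auto intro: sks_inst_fill eq_ctx)

lemma derives_fill:
  assumes "derives \<S> n P Q"
  shows "derives \<S> n (fill S P) (fill S Q)"
proof -
  obtain xs where xs: "steps_ok \<S> P xs" "last (P # map snd xs) \<approx> Q"
    "count_list (map fst xs) I_up = n"
    using assms unfolding derives_steps by blast
  let ?ys = "map (map_prod id (fill S)) xs"
  have "last (fill S P # map snd ?ys) = fill S (last (P # map snd xs))"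
    by (simp add: last_map)
  then have "last (fill S P # map snd ?ys) \<approx> fill S Q"
    using eq_ctx[OF xs(2)] by (simp only:)
  moreover have "map fst ?ys = map fst xs"
    by simp
  ultimately show ?thesis
    unfolding derives_steps using xs(1,3) steps_ok_fill by metis
qed

lemma derives_dis_left: "derives \<S> n P Q \<Longrightarrow> derives \<S> n (dis [P, R]) (dis [Q, R])"
  using derives_fill[of _ _ _ _ "DisC [] Hole [R]"] by simp

lemma derives_dis_right: "derives \<S> n P Q \<Longrightarrow> derives \<S> n (dis [R, P]) (dis [R, Q])"
  using derives_fill[of _ _ _ _ "DisC [R] Hole []"] by simp

text \<open>Parallel derivations are run in sequence: the left conjunct is rewritten first while the
  right one waits, so the cut counts add up.\<close>

lemma derives_con:
  assumes "derives \<S> m P P'" and "derives \<S> n Q Q'"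
  shows "derives \<S> (m + n) (con [P, Q]) (con [P', Q'])"
proof -
  have "derives \<S> m (con [P, Q]) (con [P', Q])"
    using derives_fill[OF assms(1), of "ConC [] Hole [Q]"] by simp
  also have "derives \<S> n (con [P', Q]) (con [P', Q'])"
    using derives_fill[OF assms(2), of "ConC [P'] Hole []"] by simp
  finally show ?thesis .
qed

section \<open>Single rules and the double switch\<close>

lemma derives_I_down: "I_down \<in> \<S> \<Longrightarrow> derives \<S> 0 TT (dis [R, Neg R])"
  using derives_rule[OF _ sks_inst.intros(1)[of Hole]] by fastforce

lemma derives_I_up: "I_up \<in> \<S> \<Longrightarrow> derives \<S> 1 (con [R, Neg R]) FF"
  using derives_rule[OF _ sks_inst.intros(2)[of Hole]] by fastforce

lemma derives_Switch:
  "Switch \<in> \<S> \<Longrightarrow> derives \<S> 0 (con [dis [R, U], T]) (dis [con [R, T], U])"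
  using derives_rule[OF _ sks_inst.intros(3)[of Hole]] by fastforce

lemma derives_W_down: "W_down \<in> \<S> \<Longrightarrow> derives \<S> 0 FF R"
  using derives_rule[OF _ sks_inst.intros(4)[of Hole]] by fastforce

lemma derives_C_down: "C_down \<in> \<S> \<Longrightarrow> derives \<S> 0 (dis [R, R]) R"
  using derives_rule[OF _ sks_inst.intros(6)[of Hole]] by fastforce

text \<open>The first switch moves \<open>U\<close> out of the conjunction; the second, after
  commuting the conjuncts, moves \<open>V\<close> out. With \<open>U\<close> and \<open>V\<close> as
  side formulae, this is the context splitting of \<open>RAnd\<close> and
  \<open>Cut\<close>.\<close>

lemma derives_Switch2:
  assumes "Switch \<in> \<S>"
  shows "derives \<S> 0 (con [dis [R, U], dis [T, V]]) (dis [dis [U, V], con [R, T]])"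
proof -
  have "derives \<S> 0 (con [R, dis [T, V]]) (dis [con [R, T], V])"
  proof -
    have "con [R, dis [T, V]] \<approx> con [dis [T, V], R]"
      by (rule eq_con_comm)
    also have "derives \<S> 0 \<dots> (dis [con [T, R], V])"
      by (rule derives_Switch[OF assms])
    also have "\<dots> \<approx> dis [con [R, T], V]"
      by (rule dis_cong[OF eq_con_comm eq_refl])
    finally show ?thesis .
  qed
  from derives_trans[OF derives_Switch[OF assms] derives_dis_left[OF this]]
  have "derives \<S> 0 (con [dis [R, U], dis [T, V]]) (dis [dis [con [R, T], V], U])"
    by simp
  also have "dis [dis [con [R, T], V], U] \<approx> dis [con [R, T], V, U]"
    using eq_dis_assoc[of "[con [R, T], V]" "[]" "[U]"] by simp
  also have "\<dots> \<approx> dis [U, V, con [R, T]]"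
    using dis_mset[of "[con [R, T], V, U]" "[U, V, con [R, T]]" "[]"] by (simp add: add_mset_commute)
  also have "\<dots> \<approx> dis [dis [U, V], con [R, T]]"
    using eq_sym[OF eq_dis_assoc[of "[U, V]" "[]" "[con [R, T]]"]] by simp
  finally show ?thesis .
qed


section \<open>Simulation of the sequent system\<close>

text \<open>\<open>AxTop\<close> and \<open>ROr\<close> are mere equivalences, and
  \<open>Ax\<close>, \<open>RC\<close> and \<open>RW\<close> take one step each. \<open>I_up\<close>
  is applied in the case of \<open>Cut\<close> only, which makes the count exact.\<close>

lemma gs_inst_derives:
  assumes "gs_inst r \<Sigma>s \<Sigma>" and "{I_down, I_up, Switch, W_down, C_down} \<subseteq> \<S>"
  shows "derives \<S> (if r = Cut then 1 else 0) (premises_struct \<Sigma>s) (sequent_struct \<Sigma>)"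
proof -
  from assms(2) have rules: "I_down \<in> \<S>" "I_up \<in> \<S>" "Switch \<in> \<S>" "W_down \<in> \<S>" "C_down \<in> \<S>"
    by auto
  \<comment> \<open>Common part of \<open>RAnd\<close> and \<open>Cut\<close>: the principal
    formulae meet in a conjunction beside the merged contexts.\<close>
  have two_premises: "derives \<S> 0 (premises_struct [\<Phi> + {#A#}, \<Psi> + {#B#}])
      (dis [sequent_struct (\<Phi> + \<Psi>), con [form_struct A, form_struct B]])" for \<Phi> \<Psi> A B
  proof -
    have "premises_struct [\<Phi> + {#A#}, \<Psi> + {#B#}]
        \<approx> con [sequent_struct (\<Phi> + {#A#}), sequent_struct (\<Psi> + {#B#})]"
      by (rule premises_struct_pair)
    also have "\<dots> \<approx> con [dis [form_struct A, sequent_struct \<Phi>], dis [form_struct B, sequent_struct \<Psi>]]"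
      by (intro con_cong sequent_struct_add_swap)
    also have "derives \<S> 0 \<dots>
        (dis [dis [sequent_struct \<Phi>, sequent_struct \<Psi>], con [form_struct A, form_struct B]])"
      by (rule derives_Switch2[OF rules(3)])
    also have "\<dots> \<approx> dis [sequent_struct (\<Phi> + \<Psi>), con [form_struct A, form_struct B]]"
      by (intro dis_cong eq_refl eq_sym[OF sequent_struct_union])
    finally show ?thesis .
  qed
  show ?thesis
    using assms(1)
  proof cases
    case 1
    then show ?thesis
      by (auto simp: premises_struct_def intro!: derives_eq eq_sym sequent_struct_single[of Top, simplified])
  next
    case (2 A)
    have "derives \<S> 0 TT (dis [form_struct A, Neg (form_struct A)])"
      by (rule derives_I_down[OF rules(1)])
    also have "\<dots> \<approx> dis [form_struct A, form_struct (dual A)]"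
      by (intro dis_cong eq_refl Neg_form_struct)
    also have "\<dots> \<approx> sequent_struct {#A, dual A#}"
      by (rule eq_sym[OF sequent_struct_pair])
    finally show ?thesis
      using 2 by (simp add: premises_struct_def)
  next
    case (3 \<Phi> A \<Psi> B)
    have "derives \<S> 0 (premises_struct [\<Phi> + {#A#}, \<Psi> + {#B#}])
        (dis [sequent_struct (\<Phi> + \<Psi>), form_struct (And A B)])"
      using two_premises by simp
    also note eq_sym[OF sequent_struct_add]
    finally show ?thesis
      using 3 by simp
  next
    case (4 \<Phi> A B)
    have "premises_struct [\<Phi> + {#A, B#}] \<approx> sequent_struct (\<Phi> + {#A, B#})"
      by (rule premises_struct_single)
    also have "\<dots> \<approx> dis [sequent_struct \<Phi>, form_struct (Or A B)]"
      using sequent_struct_add_pair by simp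
    also note eq_sym[OF sequent_struct_add]
    finally show ?thesis
      using 4 by (simp add: derives_eq)
  next
    case (5 \<Phi> A)
    have "premises_struct [\<Phi> + {#A, A#}] \<approx> sequent_struct (\<Phi> + {#A, A#})"
      by (rule premises_struct_single)
    also note sequent_struct_add_pair
    also have "derives \<S> 0 (dis [sequent_struct \<Phi>, dis [form_struct A, form_struct A]])
        (dis [sequent_struct \<Phi>, form_struct A])"
      by (rule derives_dis_right[OF derives_C_down[OF rules(5)]])
    also note eq_sym[OF sequent_struct_add]
    finally show ?thesis
      using 5 by simp
  next
    case (6 \<Phi> A)
    have "premises_struct [\<Phi>] \<approx> sequent_struct \<Phi>"
      by (rule premises_struct_single)
    \<comment> \<open>The unit \<open>FF\<close> supplies the place in which weakening creates
      \<open>A\<close>.\<close>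
    also have "\<dots> \<approx> dis [sequent_struct \<Phi>, FF]"
      by (rule eq_sym[OF dis_FF_right])
    also have "derives \<S> 0 \<dots> (dis [sequent_struct \<Phi>, form_struct A])"
      by (rule derives_dis_right[OF derives_W_down[OF rules(4)]])
    also note eq_sym[OF sequent_struct_add]
    finally show ?thesis
      using 6 by simp
  next
    case (7 \<Phi> A \<Psi>)
    have "derives \<S> 0 (premises_struct [\<Phi> + {#A#}, \<Psi> + {#dual A#}])
        (dis [sequent_struct (\<Phi> + \<Psi>), con [form_struct A, form_struct (dual A)]])"
      by (rule two_premises)
    \<comment> \<open>Restoring \<open>Neg\<close> exposes the redex of \<open>I_up\<close>; the
      \<open>FF\<close> left behind by the cut then vanishes as a unit.\<close>
    also have "\<dots> \<approx> dis [sequent_struct (\<Phi> + \<Psi>), con [form_struct A, Neg (form_struct A)]]"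
      by (intro dis_cong con_cong eq_refl eq_sym[OF Neg_form_struct])
    also have "derives \<S> 1 \<dots> (dis [sequent_struct (\<Phi> + \<Psi>), FF])"
      by (rule derives_dis_right[OF derives_I_up[OF rules(2)]])
    also note dis_FF_right
    finally show ?thesis
      using 7 by simp
  qed
qed

text \<open>To be applied with \<open>f\<close>, \<open>g\<close>, \<open>h\<close> the cuts,
  premises and conclusion of a subtree. For the empty list both sides are \<open>TT\<close>, which
  covers axiom nodes.\<close>

lemma premises_struct_derives:
  assumes "\<And>D. D \<in> set Ds \<Longrightarrow>
    derives \<S> (f D) (premises_struct (g D)) (sequent_struct (h D))"
  shows "derives \<S> (\<Sum>D\<leftarrow>Ds. f D) (premises_struct (concat (map g Ds))) (premises_struct (map h Ds))"
  using assms
proof (induction Ds)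
  case Nil
  show ?case by (simp add: derives_eq eq_refl)
next
  case (Cons D Ds)
  have "premises_struct (concat (map g (D # Ds)))
      \<approx> con [premises_struct (g D), premises_struct (concat (map g Ds))]"
    using premises_struct_append by simp
  also have "derives \<S> (f D + (\<Sum>D\<leftarrow>Ds. f D)) \<dots> (con [sequent_struct (h D), premises_struct (map h Ds)])"
    by (intro derives_con Cons) auto
  also have "\<dots> \<approx> premises_struct (map h (D # Ds))"
    using eq_sym[OF premises_struct_Cons] by simp
  finally show ?case by simp
qed

text \<open>Induction on the tree: the subtrees are simulated side by side under a conjunction, and
  the simulation of the root rule is appended below.\<close>

lemma gs_derivation_derives:
  assumes "{I_down, I_up, Switch, W_down, C_down} \<subseteq> \<S>" and "gs_derivation \<R> D"
  shows "derives \<S> (gs_cuts D) (premises_struct (gs_premises D)) (sequent_struct (gs_conclusion D))"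
  using assms(2)
proof (induction D)
  case (Open \<Sigma>)
  show ?case by (simp add: derives_eq premises_struct_single)
next
  case (Infer r \<Sigma> Ds)
  have "derives \<S> (\<Sum>D\<leftarrow>Ds. gs_cuts D) (premises_struct (concat (map gs_premises Ds)))
      (premises_struct (map gs_conclusion Ds))"
    using Infer by (intro premises_struct_derives) (auto simp: list_all_iff)
  also have "derives \<S> (if r = Cut then 1 else 0) \<dots> (sequent_struct \<Sigma>)"
    using Infer.prems assms(1) by (intro gs_inst_derives) auto
  finally show ?case
    by (simp add: add.commute)
qed

theorem theorem3p7:
  fixes D :: "'a::atom gs_deriv"
    and \<Sigma>s :: "'a sequent list"
    and \<Sigma> :: "'a sequent"
  assumes "gs_derivation (GS1p \<union> {Cut}) D"
    and "gs_premises D = \<Sigma>s"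
    and "gs_conclusion D = \<Sigma>"
  shows "\<exists>\<Delta> :: 'a sks_deriv.
           sks_derivation (SKSg - {C_up, W_up}) \<Delta>
         \<and> sks_premise \<Delta> \<approx> premises_struct \<Sigma>s
         \<and> sks_conclusion \<Delta> \<approx> sequent_struct \<Sigma>
         \<and> sks_cuts \<Delta> = gs_cuts D"
proof -
  \<comment> \<open>Removing \<open>C_up\<close> and \<open>W_up\<close> from \<open>SKSg\<close>
    leaves exactly the five rules of the simulation.\<close>
  have "{I_down, I_up, Switch, W_down, C_down} \<subseteq> SKSg - {C_up, W_up}"
    by (auto simp: SKSg_def)
  from gs_derivation_derives[OF this assms(1)] assms(2,3)
  have "derives (SKSg - {C_up, W_up}) (gs_cuts D) (premises_struct \<Sigma>s) (sequent_struct \<Sigma>)"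
    by simp
  then show ?thesis
    unfolding derives_def by (metis eq_refl)
qed

end
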